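(* For every $p\in(0,1]$, the function $h(x)=|x|^p$ is monotonically increasing and concave on the interval $[0,\infty)$. *)

theory Defs
  imports "HOL-Analysis.Analysis"
begin

end

theory Submission
  imports Defs
begin

text \<open>Weighted AM-GM gives \<open>x\<^sup>p z\<^sup>1\<^sup>-\<^sup>p \<le> p x + (1 - p) z\<close>, whose right-hand side is affine in \<open>x\<close>. Taking
  \<open>z\<close> to be a convex combination of two points and averaging the inequality over these points
  yields \<open>z\<close> on the right; dividing by \<open>z\<^sup>1\<^sup>-\<^sup>p\<close> gives concavity.\<close>

lemma concave_on_powr:
  fixes p :: real
  assumes "0 \<le> p" "p \<le> 1"
  shows "concave_on {0..} (\<lambda>x::real. x powr p)"
  unfolding concave_on_iff
proof (intro conjI ballI allI impI)
  fix x y u v :: real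
  assume x: "x \<in> {0..}" and y: "y \<in> {0..}" and uv: "u \<ge> 0" "v \<ge> 0" "u + v = 1"
  define z where "z = u * x + v * y"
  have z0: "z \<ge> 0" using x y uv by (simp add: z_def)
  have "u * x powr p + v * y powr p \<le> z powr p"
  proof (cases "z = 0")
    case True
    \<comment> \<open>Division by \<open>z powr (1 - p)\<close> is impossible here. In each product
      one factor is 0, and \<open>0 powr p = 0\<close> holds even for \<open>p = 0\<close>, so the
      left-hand side vanishes.\<close>
    then have "u * x = 0" "v * y = 0"
      using x y uv by (simp_all add: z_def add_nonneg_eq_0_iff)
    then show ?thesis by auto
  next
    case False
    with z0 have z: "z > 0" by simp
    have amgm: "a powr p * z powr (1 - p) \<le> p * a + (1 - p) * z" if "a \<ge> 0" for a
      \<comment> \<open>Young's inequality covers \<open>a > 0\<close>; at \<open>a = 0\<close> the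
        left-hand side is 0.\<close>
      using Youngs_inequality_0[of p "1 - p" a z] assms that z
      by (cases "a = 0") auto
    have "(u * x powr p + v * y powr p) * z powr (1 - p)
        = u * (x powr p * z powr (1 - p)) + v * (y powr p * z powr (1 - p))"
      by (simp add: algebra_simps)
    also have "\<dots> \<le> u * (p * x + (1 - p) * z) + v * (p * y + (1 - p) * z)"
      using x y uv by (intro add_mono mult_left_mono amgm) auto
    also have "\<dots> = p * (u * x + v * y) + (u + v) * ((1 - p) * z)"
      by (simp add: algebra_simps)
    also have "\<dots> = z"
      using uv by (simp add: algebra_simps flip: z_def)
    also have "\<dots> = z powr p * z powr (1 - p)"
      using z by (simp flip: powr_add)
    finally show ?thesis using z by simp
  qed
  then show "u * x powr p + v * y powr p \<le> (u *\<^sub>R x + v *\<^sub>R y) powr p"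
    by (simp add: z_def)
qed simp

theorem proposition1:
  fixes p :: real
  assumes "p \<in> {0<..1}"
  shows "mono_on {0..} (\<lambda>x::real. \<bar>x\<bar> powr p) \<and> concave_on {0..} (\<lambda>x::real. \<bar>x\<bar> powr p)"
proof
  show "mono_on {0..} (\<lambda>x::real. \<bar>x\<bar> powr p)"
    using assms by (auto intro!: mono_onI powr_mono2)
  have "concave_on {0..} (\<lambda>x::real. x powr p)"
    using assms by (intro concave_on_powr) auto
  \<comment> \<open>Convex combinations of nonnegative points are nonnegative, so the absolute
    values drop out.\<close>
  then show "concave_on {0..} (\<lambda>x::real. \<bar>x\<bar> powr p)"
    by (auto simp: concave_on_iff)
qed

end
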